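(* For each infinite cardinal number $\lambda$, the Banach space $\ell_\infty^c(\lambda)$ is complementably homogeneous.
   Context: Banach spaces are over a fixed scalar field, either $\mathbb{R}$ or $\mathbb{C}$. $\ell_\infty^c(\lambda)$ is the closed subspace of $\ell_\infty(\lambda)$ (bounded scalar functions on $\lambda$, supremum norm) consisting of all $z$ with $z(\alpha)\neq 0$ for at most countably many $\alpha<\lambda$. A Banach space $X$ is complementably homogeneous if for each closed subspace $Y$ of $X$ such that $Y$ is isomorphic (linearly homeomorphic) to $X$, there exists a closed, complemented subspace $Z$ of $X$ such that $Z$ is contained in $Y$ and $Z$ is isomorphic to $X$. *)

theory Defs
  imports "HOL-Probability.Discrete_Topology"
begin

text \<open>
  A Banach space over a scalar field \<open>'k\<close> is given here by a subset \<open>X\<close> of a normed type \<open>'v\<close>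
  together with a multiplication \<open>smul :: 'k \<Rightarrow> 'v \<Rightarrow> 'v\<close>: the class \<open>real_normed_vector\<close> supplies
  addition, norm and topology, but its own scalars are always real. Each notion below is intrinsic
  to \<open>X\<close> (linearity and continuity are only required on \<open>X\<close>, and a closed subspace is closed
  relative to \<open>X\<close>).
\<close>

definition closed_subspace_of ::
    "('k::real_normed_field \<Rightarrow> 'v::real_normed_vector \<Rightarrow> 'v) \<Rightarrow> 'v set \<Rightarrow> 'v set \<Rightarrow> bool" where
  "closed_subspace_of smul X Y \<longleftrightarrow> module.subspace smul Y \<and> closedin (top_of_set X) Y"

definition linear_map_on ::
    "('k::real_normed_field \<Rightarrow> 'v::real_normed_vector \<Rightarrow> 'v) \<Rightarrow> 'v set \<Rightarrow> ('v \<Rightarrow> 'v) \<Rightarrow> bool" where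
  "linear_map_on smul X T \<longleftrightarrow>
     (\<forall>x\<in>X. \<forall>y\<in>X. T (x + y) = T x + T y) \<and> (\<forall>c. \<forall>x\<in>X. T (smul c x) = smul c (T x))"

definition isomorphic_spaces ::
    "('k::real_normed_field \<Rightarrow> 'v::real_normed_vector \<Rightarrow> 'v) \<Rightarrow> 'v set \<Rightarrow> 'v set \<Rightarrow> bool" where
  "isomorphic_spaces smul X Y \<longleftrightarrow>
     (\<exists>T S. homeomorphism X Y T S \<and> linear_map_on smul X T)"

text \<open>\<open>Z\<close> is complemented in \<open>X\<close>: it is the range of a bounded linear idempotent operator on \<open>X\<close>.\<close>

definition complemented_in ::
    "('k::real_normed_field \<Rightarrow> 'v::real_normed_vector \<Rightarrow> 'v) \<Rightarrow> 'v set \<Rightarrow> 'v set \<Rightarrow> bool" where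
  "complemented_in smul X Z \<longleftrightarrow>
     Z \<subseteq> X \<and> (\<exists>P. linear_map_on smul X P \<and> continuous_on X P \<and> P ` X = Z \<and> (\<forall>x\<in>X. P (P x) = P x))"

definition complementably_homogeneous ::
    "('k::real_normed_field \<Rightarrow> 'v::real_normed_vector \<Rightarrow> 'v) \<Rightarrow> 'v set \<Rightarrow> bool" where
  "complementably_homogeneous smul X \<longleftrightarrow>
     (\<forall>Y. closed_subspace_of smul X Y \<and> isomorphic_spaces smul Y X \<longrightarrow>
       (\<exists>Z. closed_subspace_of smul X Z \<and> complemented_in smul X Z \<and> Z \<subseteq> Y \<and>
            isomorphic_spaces smul Z X))"

text \<open>
  Every function on a discrete space is continuous, so \<open>'a discrete \<Rightarrow>\<^sub>C 'k\<close> is the space of all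
  bounded functions from \<open>'a\<close> to \<open>'k\<close> with the supremum norm.
\<close>

type_synonym ('a, 'k) linf = "'a discrete \<Rightarrow>\<^sub>C 'k"

definition linf_coord :: "('a, 'k::real_normed_field) linf \<Rightarrow> 'a \<Rightarrow> 'k" where
  "linf_coord z \<alpha> = apply_bcontfun z (discrete \<alpha>)"

definition linf_scale :: "'k::real_normed_field \<Rightarrow> ('a, 'k) linf \<Rightarrow> ('a, 'k) linf" where
  "linf_scale c z = Bcontfun (\<lambda>x. c * apply_bcontfun z x)"

text \<open>
  A cardinal number is a relation \<open>r\<close> with \<open>Card_order r\<close>; the ordinals below it are the elements of
  \<open>Field r\<close>. A function on \<open>Field r\<close> is represented by its extension by zero to the whole type \<open>'a\<close>.
\<close>

definition linf :: "'a rel \<Rightarrow> ('a, 'k::real_normed_field) linf set" where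
  "linf r = {z. \<forall>\<alpha>. \<alpha> \<notin> Field r \<longrightarrow> linf_coord z \<alpha> = 0}"

definition linf_c :: "'a rel \<Rightarrow> ('a, 'k::real_normed_field) linf set" where
  "linf_c r = {z \<in> linf r. countable {\<alpha> \<in> Field r. linf_coord z \<alpha> \<noteq> 0}}"

lemma bounded_imp_bcontfun_discrete:
  fixes f :: "'a discrete \<Rightarrow> 'k::metric_space"
  assumes "bounded (range f)"
  shows "f \<in> bcontfun"
  using assms by (simp add: bcontfun_def continuous_on_open_vimage open_discrete)

lemma linf_coord_Bcontfun:
  assumes "bounded (range f)"
  shows "linf_coord (Bcontfun (\<lambda>x. f (of_discrete x))) \<alpha> = f \<alpha>"
proof -
  have "bounded (range (\<lambda>x. f (of_discrete x)))"
    using assms by (rule bounded_subset) auto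
  then show ?thesis
    by (simp add: linf_coord_def Bcontfun_inverse bounded_imp_bcontfun_discrete discrete_inverse)
qed

lemma apply_linf_scale [simp]: "apply_bcontfun (linf_scale c z) x = c * apply_bcontfun z x"
proof -
  have "bounded ((*) c ` range (apply_bcontfun z))"
    by (intro bounded_linear_image bounded_linear_mult_right) simp
  then have "bounded (range (\<lambda>x. c * apply_bcontfun z x))"
    by (simp add: image_image)
  then show ?thesis
    by (simp add: linf_scale_def Bcontfun_inverse bounded_imp_bcontfun_discrete)
qed

lemma linf_eqI: "(\<And>\<alpha>. linf_coord z \<alpha> = linf_coord w \<alpha>) \<Longrightarrow> z = w"
  by (rule bcontfun_eqI) (metis linf_coord_def of_discrete_inverse)

lemma linf_coord_simps [simp]:
  "linf_coord (z + w) \<alpha> = linf_coord z \<alpha> + linf_coord w \<alpha>"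
  "linf_coord (z - w) \<alpha> = linf_coord z \<alpha> - linf_coord w \<alpha>"
  "linf_coord 0 \<alpha> = 0"
  "linf_coord (linf_scale c z) \<alpha> = c * linf_coord z \<alpha>"
  by (simp_all add: linf_coord_def)

lemma vector_space_linf_scale: "vector_space linf_scale"
  by unfold_locales (auto intro!: linf_eqI simp: algebra_simps)

lemma linf_norm: "norm z = (SUP \<alpha>. norm (linf_coord z \<alpha>))"
proof -
  have "(SUP \<alpha>. norm (linf_coord z \<alpha>)) = (SUP x. norm (apply_bcontfun z x))"
  proof -
    have "range discrete = (UNIV :: 'a discrete set)"
      by (metis of_discrete_inverse surjI)
    then have "range (\<lambda>\<alpha>. norm (linf_coord z \<alpha>)) = range (\<lambda>x. norm (apply_bcontfun z x))"
      unfolding linf_coord_def by (metis image_image)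
    then show ?thesis by simp
  qed
  then show ?thesis
    by (simp add: norm_bcontfun_def dist_bcontfun.rep_eq)
qed

lemma norm_linf_scale: "norm (linf_scale c z) = norm c * norm z"
proof (rule antisym)
  show *: "norm (linf_scale c z) \<le> norm c * norm z" for c and z :: "('a, 'b) linf"
    by (rule norm_bound) (simp add: norm_mult mult_left_mono norm_bounded)
  show "norm c * norm z \<le> norm (linf_scale c z)"
  proof (cases "c = 0")
    case False
    have "norm z = norm (linf_scale (inverse c) (linf_scale c z))"
      using False by (intro arg_cong[where f = norm] linf_eqI) simp
    also have "\<dots> \<le> inverse (norm c) * norm (linf_scale c z)"
      using *[of "inverse c" "linf_scale c z"] by (simp add: norm_inverse)
    finally show ?thesis
      using False by (simp add: field_simps)
  qed simp
qed

lemma subspace_linf_c: "module.subspace linf_scale (linf_c r :: ('a, 'k::real_normed_field) linf set)"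
proof -
  interpret vector_space "linf_scale :: 'k \<Rightarrow> ('a, 'k) linf \<Rightarrow> _" by (rule vector_space_linf_scale)
  show ?thesis
  proof (rule subspaceI)
    fix z w :: "('a, 'k) linf"
    assume zw: "z \<in> linf_c r" "w \<in> linf_c r"
    have "{\<alpha> \<in> Field r. linf_coord (z + w) \<alpha> \<noteq> 0} \<subseteq>
        {\<alpha> \<in> Field r. linf_coord z \<alpha> \<noteq> 0} \<union> {\<alpha> \<in> Field r. linf_coord w \<alpha> \<noteq> 0}"
      by auto
    then show "z + w \<in> linf_c r"
      using zw countable_subset[OF _ countable_Un] by (fastforce simp: linf_c_def linf_def)
  next
    fix c :: 'k and z :: "('a, 'k) linf"
    assume z: "z \<in> linf_c r"
    have "{\<alpha> \<in> Field r. linf_coord (linf_scale c z) \<alpha> \<noteq> 0} \<subseteq> {\<alpha> \<in> Field r. linf_coord z \<alpha> \<noteq> 0}"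
      by auto
    then show "linf_scale c z \<in> linf_c r"
      using z countable_subset by (fastforce simp: linf_c_def linf_def)
  qed (simp add: linf_c_def linf_def)
qed

lemma closed_linf_c: "closed (linf_c r :: ('a, 'k::real_normed_field) linf set)"
  unfolding closed_sequential_limits
proof safe
  fix f and l :: "('a, 'k) linf"
  assume f: "\<forall>n. f n \<in> linf_c r" and lim: "f \<longlonglongrightarrow> l"
  have conv: "(\<lambda>n. linf_coord (f n) \<alpha>) \<longlonglongrightarrow> linf_coord l \<alpha>" for \<alpha>
    unfolding linf_coord_def
    using tendsto_bcontfun_uniform_limit[OF lim] by (rule tendsto_uniform_limitI) simp
  have zero: "linf_coord l \<alpha> = 0" if "\<And>n. linf_coord (f n) \<alpha> = 0" for \<alpha>
    using conv[of \<alpha>] that by (simp add: LIMSEQ_const_iff)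
  have "{\<alpha> \<in> Field r. linf_coord l \<alpha> \<noteq> 0} \<subseteq> (\<Union>n. {\<alpha> \<in> Field r. linf_coord (f n) \<alpha> \<noteq> 0})"
    using zero by auto
  moreover have "countable (\<Union>n. {\<alpha> \<in> Field r. linf_coord (f n) \<alpha> \<noteq> 0})"
    using f by (auto simp: linf_c_def)
  ultimately have "countable {\<alpha> \<in> Field r. linf_coord l \<alpha> \<noteq> 0}"
    by (rule countable_subset)
  moreover have "l \<in> linf r"
    using f zero by (auto simp: linf_c_def linf_def)
  ultimately show "l \<in> linf_c r"
    by (simp add: linf_c_def)
qed

lemma complete_linf_c: "complete (linf_c r :: ('a, 'k::{real_normed_field,complete_space}) linf set)"
  using closed_linf_c complete_eq_closed by blast

end

theory Submission
  imports Defs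
begin

text \<open>
  Let \<open>X\<close> be the space of bounded, countably supported functions on an infinite set \<open>\<Gamma>\<close>, and let
  \<open>T\<close> be an isomorphism of \<open>X\<close> onto a closed subspace \<open>Y\<close>. Since \<open>T\<close> is bounded below on the unit
  vectors \<open>e\<^sub>\<alpha>\<close>, there are a constant \<open>c > 0\<close> and coordinates \<open>\<beta>\<^sub>\<alpha>\<close> with \<open>\<bar>T e\<^sub>\<alpha> \<beta>\<^sub>\<alpha>\<bar> \<ge> c\<close>. The
  functionals \<open>f \<mapsto> T f \<beta>\<^sub>\<alpha>\<close> behave like finitely additive measures of uniformly bounded total
  variation, so Rosenthal's disjointification argument (\<open>rosenthal_disjointification\<close>) yields a set
  \<open>A \<subseteq> \<Gamma>\<close> of full cardinality such that for every \<open>\<alpha> \<in> A\<close> the functional with index \<open>\<alpha>\<close> has norm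
  less than \<open>c / 2\<close> on functions supported in \<open>A - {\<alpha>}\<close>. This also forces \<open>\<alpha> \<mapsto> \<beta>\<^sub>\<alpha>\<close> to be injective
  on \<open>A\<close>.

  Restrict \<open>T\<close> to the functions supported in \<open>A\<close>, and read off the coordinates \<open>\<beta>\<^sub>\<alpha>\<close>, divided by
  \<open>T e\<^sub>\<alpha> \<beta>\<^sub>\<alpha>\<close>. The composition of the two operators differs from the identity by an operator of norm
  at most \<open>1 / 2\<close>, hence is invertible. So the restriction of \<open>T\<close> has a bounded left inverse
  (\<open>almost_left_inverse_complemented\<close>), and its range, a subspace of \<open>Y\<close>, is complemented and
  isomorphic to the space over \<open>A\<close>, that is, to \<open>X\<close>.

  The injectivity of \<open>\<alpha> \<mapsto> \<beta>\<^sub>\<alpha>\<close> is what keeps the supports countable when coordinates are read off.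
  The argument is uniform in the cardinal and in the complete scalar field.
\<close>

section \<open>Rosenthal's disjointification\<close>

text \<open>
  Split \<open>\<Gamma>\<close> into \<open>\<bar>\<Gamma>\<bar>\<close> many pieces of full cardinality. If no piece works, every piece contains a
  point \<open>\<alpha>\<close> whose set function has mass at least \<open>\<epsilon>\<close> on the rest of the piece. The set of these points
  has full cardinality, and each of their set functions has lost mass \<open>\<epsilon>\<close> on it. As the masses start
  below \<open>n * \<epsilon>\<close> and remain nonnegative, fewer than \<open>n\<close> such reductions are possible.
  Superadditivity is the only trace of additivity that this uses.
\<close>

lemma rosenthal_disjointification:
  fixes m :: "'a \<Rightarrow> 'a set \<Rightarrow> real"
  assumes "infinite \<Gamma>" and "\<epsilon> > 0"
    and nonneg: "\<And>\<alpha> B. 0 \<le> m \<alpha> B"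
    and mono: "\<And>\<alpha> B C. B \<subseteq> C \<Longrightarrow> m \<alpha> B \<le> m \<alpha> C"
    and superadd: "\<And>\<alpha> B C. B \<inter> C = {} \<Longrightarrow> m \<alpha> B + m \<alpha> C \<le> m \<alpha> (B \<union> C)"
    and "\<And>\<alpha>. \<alpha> \<in> \<Gamma> \<Longrightarrow> m \<alpha> \<Gamma> < real n * \<epsilon>"
  shows "\<exists>A g. A \<subseteq> \<Gamma> \<and> bij_betw g \<Gamma> A \<and> (\<forall>\<alpha>\<in>A. m \<alpha> (A - {\<alpha>}) < \<epsilon>)"
  using assms(1,6)
proof (induction n arbitrary: \<Gamma>)
  case 0
  then obtain \<alpha> where "\<alpha> \<in> \<Gamma>"
    by fastforce
  with 0 nonneg[of \<alpha> \<Gamma>] show ?case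
    by fastforce
next
  case (Suc n)
  obtain h where h: "bij_betw h (\<Gamma> \<times> \<Gamma>) \<Gamma>"
    using card_of_Times_same_infinite[OF Suc.prems(1)] card_of_ordIso by blast
  define G where "G i = h ` ({i} \<times> \<Gamma>)" for i
  have G_sub: "G i \<subseteq> \<Gamma>" if "i \<in> \<Gamma>" for i
    using that h unfolding G_def bij_betw_def by blast
  have G_disj: "i = j" if "i \<in> \<Gamma>" "j \<in> \<Gamma>" "x \<in> G i" "x \<in> G j" for i j x
    using that h unfolding G_def bij_betw_def inj_on_def by blast
  show ?case
  proof (cases "\<exists>i\<in>\<Gamma>. \<forall>\<alpha>\<in>G i. m \<alpha> (G i - {\<alpha>}) < \<epsilon>")
    case True
    then obtain i where i: "i \<in> \<Gamma>" "\<forall>\<alpha>\<in>G i. m \<alpha> (G i - {\<alpha>}) < \<epsilon>"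
      by blast
    have "bij_betw (\<lambda>x. h (i, x)) \<Gamma> (G i)"
      using h i(1) unfolding G_def bij_betw_def inj_on_def by auto
    with i G_sub show ?thesis
      by blast
  next
    case False
    then obtain a where a: "\<And>i. i \<in> \<Gamma> \<Longrightarrow> a i \<in> G i \<and> \<epsilon> \<le> m (a i) (G i - {a i})"
      by (metis not_le)
    have inj: "inj_on a \<Gamma>"
      using a G_disj by (metis inj_onI)
    have sub: "a ` \<Gamma> \<subseteq> \<Gamma>"
      using a G_sub by blast
    have less: "m \<alpha> (a ` \<Gamma>) < real n * \<epsilon>" if \<alpha>: "\<alpha> \<in> a ` \<Gamma>" for \<alpha>
    proof -
      obtain i where i: "i \<in> \<Gamma>" "\<alpha> = a i"
        using \<alpha> by blast
      have "a ` \<Gamma> \<inter> (G i - {a i}) = {}"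
        using a G_disj i(1) by blast
      then have "m \<alpha> (a ` \<Gamma>) + m \<alpha> (G i - {a i}) \<le> m \<alpha> (a ` \<Gamma> \<union> (G i - {a i}))"
        by (rule superadd)
      also have "\<dots> \<le> m \<alpha> \<Gamma>"
        using sub G_sub[OF i(1)] by (intro mono) auto
      also have "\<dots> < real (Suc n) * \<epsilon>"
        using Suc.prems(2) \<alpha> sub by blast
      finally show ?thesis
        using a[OF i(1)] i(2) by (simp add: algebra_simps)
    qed
    have "infinite (a ` \<Gamma>)"
      using inj Suc.prems(1) finite_imageD by blast
    from Suc.IH[OF this less] obtain A g
      where A: "A \<subseteq> a ` \<Gamma>" "bij_betw g (a ` \<Gamma>) A" "\<forall>\<alpha>\<in>A. m \<alpha> (A - {\<alpha>}) < \<epsilon>"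
      by blast
    have "bij_betw (g \<circ> a) \<Gamma> A"
      using inj A(2) by (intro bij_betw_trans[of a \<Gamma> "a ` \<Gamma>"]) (simp_all add: bij_betw_def)
    with A sub show ?thesis
      by blast
  qed
qed

section \<open>Bounded linear maps on a subspace\<close>

lemma linf_subspaceD:
  fixes X :: "('a, 'k::real_normed_field) linf set"
  assumes "module.subspace linf_scale X"
  shows "0 \<in> X" "x \<in> X \<Longrightarrow> y \<in> X \<Longrightarrow> x + y \<in> X" "x \<in> X \<Longrightarrow> y \<in> X \<Longrightarrow> x - y \<in> X"
    "x \<in> X \<Longrightarrow> linf_scale c x \<in> X"
proof -
  interpret vector_space "linf_scale :: 'k \<Rightarrow> ('a, 'k) linf \<Rightarrow> _"
    by (rule vector_space_linf_scale)
  show "0 \<in> X" "x \<in> X \<Longrightarrow> y \<in> X \<Longrightarrow> x + y \<in> X" "x \<in> X \<Longrightarrow> y \<in> X \<Longrightarrow> x - y \<in> X"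
    "x \<in> X \<Longrightarrow> linf_scale c x \<in> X"
    using assms by (auto intro: subspace_0 subspace_add subspace_diff subspace_scale)
qed

lemma linear_map_on_diff:
  fixes X :: "('a, 'k::real_normed_field) linf set"
  assumes "module.subspace linf_scale X" "linear_map_on linf_scale X T" "x \<in> X" "y \<in> X"
  shows "T (x - y) = T x - T y"
proof -
  have "T ((x - y) + y) = T (x - y) + T y"
    using assms linf_subspaceD(3)[OF assms(1)] unfolding linear_map_on_def by blast
  then show ?thesis
    by simp
qed

lemma linear_map_on_compose:
  assumes "linear_map_on smul X S" "linear_map_on smul Y T" "S ` X \<subseteq> Y"
  shows "linear_map_on smul X (\<lambda>x. T (S x))"
  using assms unfolding linear_map_on_def by (metis image_subset_iff)

lemma subspace_linear_image:
  fixes X :: "('a, 'k::real_normed_field) linf set"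
  assumes "module.subspace linf_scale X" "linear_map_on linf_scale X T"
  shows "module.subspace linf_scale (T ` X)"
proof -
  interpret vector_space "linf_scale :: 'k \<Rightarrow> ('a, 'k) linf \<Rightarrow> _"
    by (rule vector_space_linf_scale)
  show ?thesis
  proof (rule subspaceI)
    have "T (0 - 0) = T 0 - T 0"
      using assms linf_subspaceD(1)[OF assms(1)] by (intro linear_map_on_diff) auto
    then show "0 \<in> T ` X"
      using linf_subspaceD(1)[OF assms(1)] by force
  next
    fix x y assume "x \<in> T ` X" "y \<in> T ` X"
    then show "x + y \<in> T ` X"
      using assms(2) linf_subspaceD(2)[OF assms(1)] unfolding linear_map_on_def
      by (metis (no_types, lifting) image_iff)
  next
    fix c x assume "x \<in> T ` X"
    then show "linf_scale c x \<in> T ` X"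
      using assms(2) linf_subspaceD(4)[OF assms(1)] unfolding linear_map_on_def
      by (metis (no_types, lifting) image_iff)
  qed
qed

lemma bounded_linear_map_on_continuous:
  fixes X :: "('a, 'k::real_normed_field) linf set"
  assumes "module.subspace linf_scale X" "linear_map_on linf_scale X T"
    and bound: "\<And>x. x \<in> X \<Longrightarrow> norm (T x) \<le> K * norm x"
  shows "continuous_on X T"
proof (rule continuous_onI)
  fix x and e :: real assume x: "x \<in> X" and e: "0 < e"
  define L where "L = \<bar>K\<bar> + 1"
  have L: "L > 0" "K \<le> L"
    by (simp_all add: L_def)
  have "dist (T y) (T x) \<le> e" if y: "y \<in> X" and d: "dist y x < e / L" for y
  proof -
    have "dist (T y) (T x) = norm (T (y - x))"
      using linear_map_on_diff[OF assms(1,2) y x] by (simp add: dist_norm)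
    also have "\<dots> \<le> K * norm (y - x)"
      using bound linf_subspaceD(3)[OF assms(1)] x y by blast
    also have "\<dots> \<le> L * norm (y - x)"
      using L by (intro mult_right_mono) auto
    also have "\<dots> \<le> e"
      using d L by (simp add: dist_norm field_simps)
    finally show ?thesis .
  qed
  then show "\<exists>d>0. \<forall>x'\<in>X. dist x' x < d \<longrightarrow> dist (T x') (T x) \<le> e"
    using e L by (intro exI[of _ "e / L"]) auto
qed

lemma continuous_linear_map_on_bounded:
  fixes X :: "('a, 'k::real_normed_field) linf set"
  assumes X: "module.subspace linf_scale X" and T: "linear_map_on linf_scale X T"
    and "continuous_on X T"
  shows "\<exists>K>0. \<forall>x\<in>X. norm (T x) \<le> K * norm x"
proof -
  have X0: "0 \<in> X"
    by (rule linf_subspaceD(1)[OF X])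
  have T0: "T 0 = 0"
    using linear_map_on_diff[OF X T X0 X0] by simp
  obtain d where d: "d > 0" "\<And>x. x \<in> X \<Longrightarrow> norm x < d \<Longrightarrow> norm (T x) < 1"
    using assms(3) X0 T0 unfolding continuous_on_iff
    by (metis dist_0_norm dist_commute zero_less_one)
  have "norm (T x) \<le> 2 / d * norm x" if x: "x \<in> X" for x
  proof (cases "x = 0")
    case False
    define c :: 'k where "c = of_real (d / (2 * norm x))"
    have c: "norm c = d / (2 * norm x)"
      using d unfolding c_def norm_of_real by simp
    have "norm (linf_scale c x) < d"
      using d False by (simp add: norm_linf_scale c)
    then have "norm (T (linf_scale c x)) < 1"
      using d x linf_subspaceD(4)[OF X] by blast
    also have "T (linf_scale c x) = linf_scale c (T x)"
      using T x unfolding linear_map_on_def by blast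
    finally show ?thesis
      using d False by (simp add: norm_linf_scale c field_simps)
  qed (simp add: T0)
  then show ?thesis
    using d by (intro exI[of _ "2 / d"]) auto
qed

section \<open>Perturbations of the identity\<close>

text \<open>
  Solving \<open>V x = y\<close> means finding a fixed point of \<open>x \<mapsto> y - (V x - x)\<close>, a contraction with
  constant \<open>1 / 2\<close> on the complete set \<open>X\<close>.
\<close>

lemma near_identity_inverse:
  fixes X :: "('a, 'k::{real_normed_field,complete_space}) linf set"
  assumes X: "module.subspace linf_scale X" "complete X"
    and V: "linear_map_on linf_scale X V" "V ` X \<subseteq> X"
    and near: "\<And>x. x \<in> X \<Longrightarrow> norm (V x - x) \<le> norm x / 2"
  shows "\<exists>W. linear_map_on linf_scale X W \<and> W ` X \<subseteq> X \<and> (\<forall>x\<in>X. W (V x) = x) \<and>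
           (\<forall>x\<in>X. norm (W x) \<le> 2 * norm x)"
proof -
  note subD = linf_subspaceD[OF X(1)]
  have V_lower: "norm x \<le> 2 * norm (V x)" if "x \<in> X" for x
    using near[OF that] norm_triangle_ineq2[of x "x - V x"] by (simp add: norm_minus_commute)
  have V_inj: "x = y" if "x \<in> X" "y \<in> X" "V x = V y" for x y
    using V_lower[OF subD(3)[OF that(1,2)]] linear_map_on_diff[OF X(1) V(1) that(1,2)] that(3)
    by simp
  have "\<exists>x\<in>X. V x = y" if y: "y \<in> X" for y
  proof -
    have "\<exists>!x. x \<in> X \<and> y - (V x - x) = x"
    proof (rule Banach_fix[OF X(2)])
      show "X \<noteq> {}"
        using subD(1) by blast
      show "(\<lambda>x. y - (V x - x)) ` X \<subseteq> X"
        using y V(2) subD(3) by blast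
      show "dist (y - (V x - x)) (y - (V z - z)) \<le> 1 / 2 * dist x z"
        if xz: "x \<in> X" "z \<in> X" for x z
      proof -
        have "(y - (V x - x)) - (y - (V z - z)) = - (V (x - z) - (x - z))"
          by (simp add: linear_map_on_diff[OF X(1) V(1) xz])
        then have "dist (y - (V x - x)) (y - (V z - z)) = norm (V (x - z) - (x - z))"
          by (simp only: dist_norm norm_minus_cancel)
        also have "\<dots> \<le> 1 / 2 * dist x z"
          using near[OF subD(3)[OF xz]] by (simp add: dist_norm)
        finally show ?thesis .
      qed
    qed simp_all
    then show ?thesis
      by (metis add_diff_cancel_left' diff_add_cancel diff_diff_eq2)
  qed
  then obtain W where W: "\<And>y. y \<in> X \<Longrightarrow> W y \<in> X" "\<And>y. y \<in> X \<Longrightarrow> V (W y) = y"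
    by metis
  have "linear_map_on linf_scale X W"
    unfolding linear_map_on_def
  proof (intro conjI ballI allI)
    fix x y assume xy: "x \<in> X" "y \<in> X"
    have "V (W x + W y) = x + y"
      using V(1) W xy unfolding linear_map_on_def by simp
    then show "W (x + y) = W x + W y"
      using xy W subD(2) by - (rule V_inj, auto)
  next
    fix c x assume x: "x \<in> X"
    have "V (linf_scale c (W x)) = linf_scale c x"
      using V(1) W x unfolding linear_map_on_def by simp
    then show "W (linf_scale c x) = linf_scale c (W x)"
      using x W subD(4) by - (rule V_inj, auto)
  qed
  moreover have "W (V x) = x" if "x \<in> X" for x
    using that V(2) W by - (rule V_inj, auto)
  moreover have "norm (W x) \<le> 2 * norm x" if "x \<in> X" for x
    using V_lower[OF W(1)[OF that]] W(2)[OF that] by simp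
  ultimately show ?thesis
    using W(1) by blast
qed

text \<open>
  With \<open>W\<close> the inverse of \<open>R \<circ> E\<close>, the map \<open>W \<circ> R\<close> is a bounded left inverse of \<open>E\<close>. Hence
  \<open>E \<circ> W \<circ> R\<close> is a projection onto the range of \<open>E\<close>, and \<open>E\<close> is an isomorphism onto its range.
\<close>

lemma almost_left_inverse_complemented:
  fixes X :: "('a, 'k::{real_normed_field,complete_space}) linf set"
  assumes X: "module.subspace linf_scale X" "complete X"
    and E: "linear_map_on linf_scale X E" "E ` X \<subseteq> X" "continuous_on X E"
    and R: "linear_map_on linf_scale X R" "R ` X \<subseteq> X" "continuous_on X R"
    and near: "\<And>x. x \<in> X \<Longrightarrow> norm (R (E x) - x) \<le> norm x / 2"
  shows "closed_subspace_of linf_scale X (E ` X)" "complemented_in linf_scale X (E ` X)"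
    "isomorphic_spaces linf_scale (E ` X) X"
proof -
  obtain W where W: "linear_map_on linf_scale X W" "W ` X \<subseteq> X" "\<And>x. x \<in> X \<Longrightarrow> W (R (E x)) = x"
      "\<And>x. x \<in> X \<Longrightarrow> norm (W x) \<le> 2 * norm x"
    using near_identity_inverse[OF X linear_map_on_compose[OF E(1) R(1) E(2)] _ near] E(2) R(2)
    by (auto simp: image_subset_iff)
  define Q where "Q x = W (R x)" for x
  have Q_lin: "linear_map_on linf_scale X Q"
    unfolding Q_def by (rule linear_map_on_compose[OF R(1) W(1) R(2)])
  have Q_cont: "continuous_on X Q"
    unfolding Q_def using bounded_linear_map_on_continuous[OF X(1) W(1,4)] R(2,3)
    by (intro continuous_on_compose2[of X W X R]) auto
  have Q_in: "Q x \<in> X" if "x \<in> X" for x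
    using that R(2) W(2) unfolding Q_def by blast
  have QE: "Q (E x) = x" if "x \<in> X" for x
    using W(3)[OF that] by (simp add: Q_def)
  have P_cont: "continuous_on X (\<lambda>x. E (Q x))"
    using E(3) Q_cont Q_in by (intro continuous_on_compose2[of X E X Q]) auto
  have P_range: "(\<lambda>x. E (Q x)) ` X = E ` X"
    using QE Q_in E(2) by (force simp: image_iff)
  show "complemented_in linf_scale X (E ` X)"
    unfolding complemented_in_def
    using E(2) P_cont P_range QE Q_in linear_map_on_compose[OF Q_lin E(1)]
    by (intro conjI exI[of _ "\<lambda>x. E (Q x)"]) auto
  \<comment> \<open>The range of a projection is its set of fixed points, hence closed.\<close>
  have "E ` X = {x \<in> X. E (Q x) - x = 0}"
    using QE Q_in E(2) by force
  moreover have "closedin (top_of_set X) {x \<in> X. E (Q x) - x = 0}"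
    by (intro continuous_closedin_preimage_constant continuous_on_diff P_cont continuous_on_id)
  ultimately show "closed_subspace_of linf_scale X (E ` X)"
    unfolding closed_subspace_of_def using subspace_linear_image[OF X(1) E(1)] by simp
  have "homeomorphism (E ` X) X Q E"
    using E Q_cont QE Q_in
    by (auto simp: homeomorphism_def image_image intro: continuous_on_subset)
  moreover have "linear_map_on linf_scale (E ` X) Q"
    using Q_lin E(2) unfolding linear_map_on_def by blast
  ultimately show "isomorphic_spaces linf_scale (E ` X) X"
    unfolding isomorphic_spaces_def by blast
qed

section \<open>Operators and functionals on the countably supported functions\<close>

lemma norm_linf_coord_le: "norm (linf_coord z \<alpha>) \<le> norm z"
  unfolding linf_coord_def by (rule norm_bounded)

lemma norm_linf_le:
  assumes "\<And>\<alpha>. norm (linf_coord z \<alpha>) \<le> c"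
  shows "norm z \<le> c"
  using assms unfolding linf_coord_def by (intro norm_bound) (metis of_discrete_inverse)

definition weighted_comp ::
    "('a \<Rightarrow> 'k::real_normed_field) \<Rightarrow> ('a \<Rightarrow> 'a) \<Rightarrow> ('a, 'k) linf \<Rightarrow> ('a, 'k) linf" where
  "weighted_comp w \<sigma> f = Bcontfun (\<lambda>x. w (of_discrete x) * linf_coord f (\<sigma> (of_discrete x)))"

lemma linf_coord_weighted_comp:
  assumes "\<And>x. norm (w x) \<le> K"
  shows "linf_coord (weighted_comp w \<sigma> f) x = w x * linf_coord f (\<sigma> x)"
proof -
  have K: "0 \<le> K"
    using norm_ge_zero assms by (rule order_trans)
  have "bounded (range (\<lambda>x. w x * linf_coord f (\<sigma> x)))"
    by (rule boundedI[of _ "K * norm f"])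
      (auto simp: norm_mult K intro!: mult_mono assms norm_linf_coord_le)
  from linf_coord_Bcontfun[OF this] show ?thesis
    by (simp add: weighted_comp_def)
qed

lemma weighted_comp_bounded_linear:
  assumes w: "\<And>x. norm (w x) \<le> K"
  shows "linear_map_on linf_scale X (weighted_comp w \<sigma>)" "norm (weighted_comp w \<sigma> f) \<le> K * norm f"
proof -
  have K: "0 \<le> K"
    using norm_ge_zero w by (rule order_trans)
  show "linear_map_on linf_scale X (weighted_comp w \<sigma>)"
    unfolding linear_map_on_def
    by (auto intro!: linf_eqI simp: linf_coord_weighted_comp[OF w] algebra_simps)
  show "norm (weighted_comp w \<sigma> f) \<le> K * norm f"
    by (rule norm_linf_le)
      (auto simp: linf_coord_weighted_comp[OF w] norm_mult K intro!: mult_mono w norm_linf_coord_le)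
qed

text \<open>Injectivity of \<open>\<sigma>\<close> where \<open>w\<close> does not vanish makes preimages of countable sets countable.\<close>

lemma weighted_comp_linf_c:
  assumes w: "\<And>x. norm (w x) \<le> K" and "\<And>x. x \<notin> Field r \<Longrightarrow> w x = 0"
    and inj: "inj_on \<sigma> {x. w x \<noteq> 0}" and f: "f \<in> linf_c r"
  shows "weighted_comp w \<sigma> f \<in> linf_c r"
proof -
  let ?S = "{x \<in> Field r. linf_coord (weighted_comp w \<sigma> f) x \<noteq> 0}"
  have "\<sigma> ` ?S \<subseteq> {\<alpha> \<in> Field r. linf_coord f \<alpha> \<noteq> 0}"
    using f by (auto simp: linf_coord_weighted_comp[OF w] linf_c_def linf_def)
  then have "countable (\<sigma> ` ?S)"
    using f countable_subset by (auto simp: linf_c_def)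
  moreover have "inj_on \<sigma> ?S"
    using inj by (rule inj_on_subset) (auto simp: linf_coord_weighted_comp[OF w])
  ultimately have "countable ?S"
    by (rule countable_image_inj_on)
  then show ?thesis
    using assms(2) by (simp add: linf_c_def linf_def linf_coord_weighted_comp[OF w])
qed

definition unit_vec :: "'a \<Rightarrow> ('a, 'k::real_normed_field) linf" where
  "unit_vec \<alpha> = Bcontfun (\<lambda>x. if of_discrete x = \<alpha> then 1 else 0)"

lemma linf_coord_unit_vec: "linf_coord (unit_vec \<alpha>) x = (if x = \<alpha> then 1 else 0)"
proof -
  have "bounded (range (\<lambda>x. if x = \<alpha> then 1 else 0 :: 'k::real_normed_field))"
    by (rule boundedI[of _ 1]) auto
  from linf_coord_Bcontfun[OF this, of x] show ?thesis
    unfolding unit_vec_def .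
qed

lemma unit_vec_linf_c: "\<alpha> \<in> Field r \<Longrightarrow> unit_vec \<alpha> \<in> linf_c r"
  by (auto simp: linf_c_def linf_def linf_coord_unit_vec)

lemma norm_unit_vec: "norm (unit_vec \<alpha> :: ('a, 'k::real_normed_field) linf) = 1"
proof (rule antisym)
  show "norm (unit_vec \<alpha> :: ('a, 'k) linf) \<le> 1"
    by (rule norm_linf_le) (simp add: linf_coord_unit_vec)
  show "1 \<le> norm (unit_vec \<alpha> :: ('a, 'k) linf)"
    using norm_linf_coord_le[of "unit_vec \<alpha> :: ('a, 'k) linf" \<alpha>] by (simp add: linf_coord_unit_vec)
qed

definition unit_ball_on :: "('a, 'k::real_normed_field) linf set \<Rightarrow> 'a set \<Rightarrow> ('a, 'k) linf set" where
  "unit_ball_on X B = {f \<in> X. norm f \<le> 1 \<and> (\<forall>x. x \<notin> B \<longrightarrow> linf_coord f x = 0)}"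

text \<open>
  If the functional is viewed as a finitely additive measure, this is its total variation on \<open>B\<close>.
\<close>

definition functional_mass ::
    "('a, 'k::real_normed_field) linf set \<Rightarrow> (('a, 'k) linf \<Rightarrow> 'k) \<Rightarrow> 'a set \<Rightarrow> real" where
  "functional_mass X \<phi> B = (SUP f\<in>unit_ball_on X B. norm (\<phi> f))"

locale bounded_functional_on =
  fixes X :: "('a, 'k::real_normed_field) linf set" and \<phi> :: "('a, 'k) linf \<Rightarrow> 'k" and K :: real
  assumes X: "module.subspace linf_scale X"
    and \<phi>_add: "\<And>f g. f \<in> X \<Longrightarrow> g \<in> X \<Longrightarrow> \<phi> (f + g) = \<phi> f + \<phi> g"
    and \<phi>_scale: "\<And>c f. f \<in> X \<Longrightarrow> \<phi> (linf_scale c f) = c * \<phi> f"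
    and \<phi>_bound: "\<And>f. f \<in> X \<Longrightarrow> norm (\<phi> f) \<le> K * norm f" and K: "0 \<le> K"
begin

lemma zero_in_unit_ball_on: "0 \<in> unit_ball_on X B"
  using linf_subspaceD(1)[OF X] by (simp add: unit_ball_on_def)

lemma norm_functional_unit_ball: "f \<in> unit_ball_on X B \<Longrightarrow> norm (\<phi> f) \<le> K"
  using \<phi>_bound[of f] mult_left_mono[of "norm f" 1 K] K by (simp add: unit_ball_on_def)

lemma functional_mass_upper: "f \<in> unit_ball_on X B \<Longrightarrow> norm (\<phi> f) \<le> functional_mass X \<phi> B"
  unfolding functional_mass_def
  by (rule cSUP_upper) (auto intro!: bdd_aboveI2 norm_functional_unit_ball)

lemma functional_mass_least:
  "(\<And>f. f \<in> unit_ball_on X B \<Longrightarrow> norm (\<phi> f) \<le> c) \<Longrightarrow> functional_mass X \<phi> B \<le> c"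
  unfolding functional_mass_def using zero_in_unit_ball_on by (intro cSUP_least) auto

lemma functional_mass_nonneg: "0 \<le> functional_mass X \<phi> B"
  using norm_ge_zero functional_mass_upper[OF zero_in_unit_ball_on] by (rule order_trans)

lemma functional_mass_le: "functional_mass X \<phi> B \<le> K"
  by (rule functional_mass_least) (rule norm_functional_unit_ball)

lemma functional_mass_mono: "B \<subseteq> C \<Longrightarrow> functional_mass X \<phi> B \<le> functional_mass X \<phi> C"
  by (intro functional_mass_least functional_mass_upper) (auto simp: unit_ball_on_def)

text \<open>
  Rotate two disjointly supported functions of norm at most \<open>1\<close> by unimodular scalars so that the
  values of the functional on them become nonnegative. The norm of their sum is still at most \<open>1\<close>,
  and the values add up.
\<close>

lemma functional_mass_superadditive:
  assumes disj: "B \<inter> C = {}"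
  shows "functional_mass X \<phi> B + functional_mass X \<phi> C \<le> functional_mass X \<phi> (B \<union> C)"
proof -
  have rot: "\<exists>f'\<in>unit_ball_on X D. \<phi> f' = of_real (norm (\<phi> f))" if f: "f \<in> unit_ball_on X D" for f D
  proof (cases "\<phi> f = 0")
    case False
    define c where "c = of_real (norm (\<phi> f)) / \<phi> f"
    have "norm c = 1"
      using False by (simp add: c_def norm_divide)
    then have "linf_scale c f \<in> unit_ball_on X D"
      using f linf_subspaceD(4)[OF X] by (simp add: unit_ball_on_def norm_linf_scale)
    moreover have "\<phi> (linf_scale c f) = of_real (norm (\<phi> f))"
      using f False by (simp add: unit_ball_on_def \<phi>_scale c_def)
    ultimately show ?thesis
      by blast
  qed (use f in force)
  have sum: "norm (\<phi> f) + norm (\<phi> g) \<le> functional_mass X \<phi> (B \<union> C)"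
    if f: "f \<in> unit_ball_on X B" and g: "g \<in> unit_ball_on X C" for f g
  proof -
    obtain f' g' where f': "f' \<in> unit_ball_on X B" "\<phi> f' = of_real (norm (\<phi> f))"
      and g': "g' \<in> unit_ball_on X C" "\<phi> g' = of_real (norm (\<phi> g))"
      using rot[OF f] rot[OF g] by blast
    have "norm (linf_coord (f' + g') x) \<le> 1" for x
      using f'(1) g'(1) disj norm_linf_coord_le[of f' x] norm_linf_coord_le[of g' x]
      by (cases "x \<in> B") (auto simp: unit_ball_on_def)
    then have "f' + g' \<in> unit_ball_on X (B \<union> C)"
      using f'(1) g'(1) linf_subspaceD(2)[OF X] by (auto simp: unit_ball_on_def intro: norm_linf_le)
    from functional_mass_upper[OF this] show ?thesis
      using f' g' by (simp add: unit_ball_on_def \<phi>_add flip: of_real_add)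
  qed
  have "functional_mass X \<phi> C \<le> functional_mass X \<phi> (B \<union> C) - norm (\<phi> f)"
    if "f \<in> unit_ball_on X B" for f
    using sum[OF that] by (intro functional_mass_least) (simp add: algebra_simps)
  then have "functional_mass X \<phi> B \<le> functional_mass X \<phi> (B \<union> C) - functional_mass X \<phi> C"
    by (intro functional_mass_least) (simp add: algebra_simps)
  then show ?thesis
    by simp
qed

lemma norm_functional_le_mass:
  assumes "f \<in> X" and supp: "\<And>x. x \<notin> B \<Longrightarrow> linf_coord f x = 0"
  shows "norm (\<phi> f) \<le> functional_mass X \<phi> B * norm f"
proof (cases "f = 0")
  case True
  then show ?thesis
    using \<phi>_bound[OF assms(1)] by simp
next
  case False
  define c :: 'k where "c = of_real (1 / norm f)"
  have c: "norm c = 1 / norm f"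
    unfolding c_def norm_of_real by simp
  have "linf_scale c f \<in> unit_ball_on X B"
    using False assms linf_subspaceD(4)[OF X] by (simp add: unit_ball_on_def norm_linf_scale c)
  from functional_mass_upper[OF this] show ?thesis
    using False assms(1) by (simp add: \<phi>_scale norm_mult c field_simps)
qed

end

section \<open>Complemented copies inside isomorphic copies\<close>

text \<open>
  Rosenthal's lemma applied to the functionals \<open>f \<mapsto> T f \<beta>\<^sub>\<alpha>\<close>. If \<open>\<beta>\<^sub>\<alpha> = \<beta>\<^sub>\<gamma>\<close> for distinct \<open>\<alpha>\<close>, \<open>\<gamma>\<close>
  in \<open>A\<close>, then \<open>e\<^sub>\<gamma>\<close>, which is supported off \<open>\<alpha>\<close>, would have an image of size at least \<open>c\<close> at
  \<open>\<beta>\<^sub>\<alpha>\<close>; so smallness off the diagonal includes injectivity.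
\<close>

lemma almost_diagonal_index_set:
  fixes T :: "('a, 'k::{real_normed_field,complete_space}) linf \<Rightarrow> ('a, 'k) linf"
  assumes inf: "infinite (Field r)"
    and T: "linear_map_on linf_scale (linf_c r) T"
      "\<And>f. f \<in> linf_c r \<Longrightarrow> norm (T f) \<le> K * norm f"
    and c: "c > 0" "\<And>\<alpha>. \<alpha> \<in> Field r \<Longrightarrow> c \<le> norm (linf_coord (T (unit_vec \<alpha>)) (\<beta> \<alpha>))"
  shows "\<exists>A g. A \<subseteq> Field r \<and> bij_betw g (Field r) A \<and> inj_on \<beta> A \<and>
           (\<forall>\<alpha>\<in>A. \<forall>f\<in>linf_c r. (\<forall>x. x \<notin> A - {\<alpha>} \<longrightarrow> linf_coord f x = 0) \<longrightarrow>
              norm (linf_coord (T f) (\<beta> \<alpha>)) \<le> c / 2 * norm f)"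
proof -
  let ?X = "linf_c r :: ('a, 'k) linf set"
  define \<phi> where "\<phi> \<alpha> f = linf_coord (T f) (\<beta> \<alpha>)" for \<alpha> f
  define M where "M = max K 0"
  have \<phi>: "\<phi> \<alpha> (f + h) = \<phi> \<alpha> f + \<phi> \<alpha> h" "\<phi> \<alpha> (linf_scale s f) = s * \<phi> \<alpha> f"
      "norm (\<phi> \<alpha> f) \<le> M * norm f" if "f \<in> ?X" "h \<in> ?X" for \<alpha> f h s
  proof -
    show "\<phi> \<alpha> (f + h) = \<phi> \<alpha> f + \<phi> \<alpha> h" "\<phi> \<alpha> (linf_scale s f) = s * \<phi> \<alpha> f"
      using T(1) that unfolding linear_map_on_def \<phi>_def by simp_all
    have "norm (\<phi> \<alpha> f) \<le> K * norm f"
      unfolding \<phi>_def using norm_linf_coord_le T(2)[OF that(1)] by (rule order_trans)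
    also have "\<dots> \<le> M * norm f"
      by (rule mult_right_mono) (simp_all add: M_def)
    finally show "norm (\<phi> \<alpha> f) \<le> M * norm f" .
  qed
  have M: "0 \<le> M"
    by (simp add: M_def)
  interpret bounded_functional_on ?X "\<phi> \<alpha>" M for \<alpha>
    using subspace_linf_c \<phi> M by unfold_locales auto
  obtain n where n: "M < real n * (c / 2)"
    using reals_Archimedean3[of "c / 2"] c(1) by auto
  have "\<exists>A g. A \<subseteq> Field r \<and> bij_betw g (Field r) A \<and>
      (\<forall>\<alpha>\<in>A. functional_mass ?X (\<phi> \<alpha>) (A - {\<alpha>}) < c / 2)"
  proof (rule rosenthal_disjointification[OF inf])
    show "functional_mass ?X (\<phi> \<alpha>) (Field r) < real n * (c / 2)" for \<alpha>
      using functional_mass_le n by (rule order_le_less_trans)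
  qed (use c functional_mass_nonneg functional_mass_mono
         functional_mass_superadditive in auto)
  then obtain A g where A: "A \<subseteq> Field r" "bij_betw g (Field r) A"
      "\<And>\<alpha>. \<alpha> \<in> A \<Longrightarrow> functional_mass ?X (\<phi> \<alpha>) (A - {\<alpha>}) < c / 2"
    by blast
  have small: "norm (\<phi> \<alpha> f) \<le> c / 2 * norm f"
    if "\<alpha> \<in> A" "f \<in> ?X" "\<And>x. x \<notin> A - {\<alpha>} \<Longrightarrow> linf_coord f x = 0" for \<alpha> f
  proof -
    have "norm (\<phi> \<alpha> f) \<le> functional_mass ?X (\<phi> \<alpha>) (A - {\<alpha>}) * norm f"
      using norm_functional_le_mass[OF that(2,3)] by blast
    also have "\<dots> \<le> c / 2 * norm f"
      using A(3)[OF that(1)] by (intro mult_right_mono) auto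
    finally show ?thesis .
  qed
  have "inj_on \<beta> A"
  proof (rule inj_onI, rule ccontr)
    fix \<alpha> \<gamma> assume *: "\<alpha> \<in> A" "\<gamma> \<in> A" "\<beta> \<alpha> = \<beta> \<gamma>" "\<alpha> \<noteq> \<gamma>"
    have "norm (\<phi> \<alpha> (unit_vec \<gamma>)) \<le> c / 2 * norm (unit_vec \<gamma> :: ('a, 'k) linf)"
      using * A(1) by (intro small) (auto simp: linf_coord_unit_vec intro: unit_vec_linf_c)
    moreover have "c \<le> norm (\<phi> \<alpha> (unit_vec \<gamma>))"
      using * A(1) c(2)[of \<gamma>] by (auto simp: \<phi>_def)
    ultimately show False
      using c(1) by (simp add: norm_unit_vec)
  qed
  with A(1,2) small show ?thesis
    unfolding \<phi>_def by blast
qed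

text \<open>
  \<open>E\<close> is \<open>T\<close> after the isometry that moves a function on the index set to \<open>A\<close> along \<open>g\<close>; \<open>R\<close> reads
  off the coordinates \<open>\<beta>\<^sub>\<alpha>\<close>, normalised by the diagonal entries, and moves them back along \<open>g\<close>. The
  diagonal part of \<open>R \<circ> E\<close> is the identity, and the remainder is controlled by the smallness off the
  diagonal.
\<close>

lemma complemented_copy_in_range:
  fixes T :: "('a, 'k::{real_normed_field,complete_space}) linf \<Rightarrow> ('a, 'k) linf"
  assumes inf: "infinite (Field r)"
    and T: "linear_map_on linf_scale (linf_c r) T" "T ` linf_c r \<subseteq> linf_c r"
      "\<And>f. f \<in> linf_c r \<Longrightarrow> norm (T f) \<le> K * norm f"
    and c: "c > 0" "\<And>\<alpha>. \<alpha> \<in> Field r \<Longrightarrow> c \<le> norm (linf_coord (T (unit_vec \<alpha>)) (\<beta> \<alpha>))"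
  shows "\<exists>Z \<subseteq> T ` linf_c r. closed_subspace_of linf_scale (linf_c r) Z \<and>
           complemented_in linf_scale (linf_c r) Z \<and> isomorphic_spaces linf_scale Z (linf_c r)"
proof -
  let ?X = "linf_c r :: ('a, 'k) linf set"
  obtain A g where A: "A \<subseteq> Field r" and g: "bij_betw g (Field r) A" and \<beta>: "inj_on \<beta> A"
    and small: "\<And>\<alpha> f. \<alpha> \<in> A \<Longrightarrow> f \<in> ?X \<Longrightarrow> (\<And>x. x \<notin> A - {\<alpha>} \<Longrightarrow> linf_coord f x = 0) \<Longrightarrow>
        norm (linf_coord (T f) (\<beta> \<alpha>)) \<le> c / 2 * norm f"
    using almost_diagonal_index_set[OF inf T(1,3) c] by blast
  have gA: "g x \<in> A" if "x \<in> Field r" for x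
    using that g by (auto simp: bij_betw_def)
  define d where "d \<alpha> = linf_coord (T (unit_vec \<alpha>)) (\<beta> \<alpha>)" for \<alpha>
  have d: "c \<le> norm (d \<alpha>)" if "\<alpha> \<in> Field r" for \<alpha>
    using c(2)[OF that] by (simp add: d_def)
  define u :: "'a \<Rightarrow> 'k" where "u x = (if x \<in> A then 1 else 0)" for x
  define v :: "'a \<Rightarrow> 'k" where "v x = (if x \<in> Field r then 1 / d (g x) else 0)" for x
  define J where "J = weighted_comp u (inv_into (Field r) g)"
  define R where "R = weighted_comp v (\<lambda>x. \<beta> (g x))"
  have u: "norm (u x) \<le> 1" for x
    by (simp add: u_def)
  have v: "norm (v x) \<le> 1 / c" for x
    using d[of "g x"] gA[of x] A c(1) by (auto simp: v_def norm_divide intro!: frac_le)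
  have J_coord: "linf_coord (J f) x = u x * linf_coord f (inv_into (Field r) g x)" for f x
    unfolding J_def by (rule linf_coord_weighted_comp[OF u])
  have R_coord: "linf_coord (R f) x = v x * linf_coord f (\<beta> (g x))" for f x
    unfolding R_def by (rule linf_coord_weighted_comp[OF v])
  have J_lin: "linear_map_on linf_scale ?X J" and J_norm: "norm (J f) \<le> 1 * norm f" for f
    unfolding J_def by (rule weighted_comp_bounded_linear[OF u])+
  have R_lin: "linear_map_on linf_scale ?X R" and R_norm: "norm (R f) \<le> 1 / c * norm f" for f
    unfolding R_def by (rule weighted_comp_bounded_linear[OF v])+
  have J_in: "J f \<in> ?X" if "f \<in> ?X" for f
    unfolding J_def
  proof (rule weighted_comp_linf_c[OF u _ _ that])
    show "inj_on (inv_into (Field r) g) {x. u x \<noteq> 0}"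
      using g by (auto simp: u_def bij_betw_def intro: inj_on_inv_into)
  qed (use A in \<open>auto simp: u_def\<close>)
  have R_in: "R f \<in> ?X" if "f \<in> ?X" for f
    unfolding R_def
  proof (rule weighted_comp_linf_c[OF v _ _ that])
    have "inj_on (\<lambda>x. \<beta> (g x)) (Field r)"
      using g \<beta> comp_inj_on[of g "Field r" \<beta>] by (simp add: bij_betw_def comp_def)
    then show "inj_on (\<lambda>x. \<beta> (g x)) {x. v x \<noteq> 0}"
      by (rule inj_on_subset) (auto simp: v_def)
  qed (auto simp: v_def)
  have near: "norm (R (T (J f)) - f) \<le> norm f / 2" if f: "f \<in> ?X" for f
  proof (rule norm_linf_le)
    fix x
    show "norm (linf_coord (R (T (J f)) - f) x) \<le> norm f / 2"
    proof (cases "x \<in> Field r")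
      case False
      then show ?thesis
        using f by (simp add: R_coord v_def linf_c_def linf_def)
    next
      case True
      define \<alpha> where "\<alpha> = g x"
      have \<alpha>: "\<alpha> \<in> A" "\<alpha> \<in> Field r"
        using True gA A by (auto simp: \<alpha>_def)
      have inv: "inv_into (Field r) g \<alpha> = x"
        using True g by (simp add: \<alpha>_def bij_betw_def)
      define t where "t = linf_coord f x"
      define h where "h = J f - linf_scale t (unit_vec \<alpha>)"
      have unit_in: "unit_vec \<alpha> \<in> ?X"
        using \<alpha>(2) by (rule unit_vec_linf_c)
      then have unit: "linf_scale t (unit_vec \<alpha>) \<in> ?X"
        by (rule linf_subspaceD(4)[OF subspace_linf_c])
      have h_in: "h \<in> ?X"
        unfolding h_def using f unit by (intro linf_subspaceD(3)[OF subspace_linf_c] J_in)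
      have h_coord: "linf_coord h y = (if y = \<alpha> then 0 else linf_coord (J f) y)" for y
        using inv \<alpha>(1) by (auto simp: h_def J_coord linf_coord_unit_vec u_def t_def)
      have h_norm: "norm h \<le> norm f"
      proof (rule norm_linf_le)
        show "norm (linf_coord h y) \<le> norm f" for y
          using order_trans[OF norm_linf_coord_le J_norm, of f y] by (simp add: h_coord)
      qed
      have "T h = T (J f) - T (linf_scale t (unit_vec \<alpha>))"
        unfolding h_def by (rule linear_map_on_diff[OF subspace_linf_c T(1) J_in[OF f] unit])
      also have "T (linf_scale t (unit_vec \<alpha>)) = linf_scale t (T (unit_vec \<alpha>))"
        using T(1) unit_in unfolding linear_map_on_def by simp
      finally have "linf_coord (T h) (\<beta> \<alpha>) = linf_coord (T (J f)) (\<beta> \<alpha>) - t * d \<alpha>"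
        by (simp add: d_def)
      moreover have "d \<alpha> \<noteq> 0"
        using d[OF \<alpha>(2)] c(1) by auto
      ultimately have "linf_coord (R (T (J f)) - f) x = linf_coord (T h) (\<beta> \<alpha>) / d \<alpha>"
        using True by (simp add: R_coord v_def \<alpha>_def[symmetric] t_def[symmetric] field_simps)
      also have "norm \<dots> \<le> (c / 2 * norm h) / c"
        unfolding norm_divide
      proof (rule frac_le)
        show "norm (linf_coord (T h) (\<beta> \<alpha>)) \<le> c / 2 * norm h"
          using \<alpha>(1) h_in by (rule small) (auto simp: h_coord J_coord u_def)
      qed (use d[OF \<alpha>(2)] c(1) in auto)
      also have "\<dots> \<le> norm f / 2"
        using h_norm c(1) by simp
      finally show ?thesis .
    qed
  qed
  have cont: "continuous_on ?X T" "continuous_on ?X J" "continuous_on ?X R"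
    using bounded_linear_map_on_continuous[OF subspace_linf_c T(1,3)]
      bounded_linear_map_on_continuous[OF subspace_linf_c J_lin J_norm]
      bounded_linear_map_on_continuous[OF subspace_linf_c R_lin R_norm] by blast+
  define E where "E f = T (J f)" for f
  have E_lin: "linear_map_on linf_scale ?X E"
    unfolding E_def using J_in by (intro linear_map_on_compose[OF J_lin T(1)]) auto
  have E_range: "E ` ?X \<subseteq> T ` ?X"
    using J_in by (auto simp: E_def)
  then have E_in: "E ` ?X \<subseteq> ?X"
    using T(2) by blast
  have E_cont: "continuous_on ?X E"
    unfolding E_def using J_in by (intro continuous_on_compose2[OF cont(1,2)]) auto
  have "R ` ?X \<subseteq> ?X"
    using R_in by blast
  from almost_left_inverse_complemented[OF subspace_linf_c complete_linf_c E_lin E_in E_cont R_lin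
      this cont(3) near[folded E_def]] E_range show ?thesis
    by blast
qed

text \<open>
  The bounded inverse of the isomorphism keeps the images of the unit vectors away from \<open>0\<close>, so each
  of them has a coordinate of size at least half the resulting bound.
\<close>

lemma complementably_homogeneous_linf_c:
  assumes inf: "infinite (Field r)"
  shows "complementably_homogeneous linf_scale
           (linf_c r :: ('a, 'k::{real_normed_field,complete_space}) linf set)"
  unfolding complementably_homogeneous_def
proof (intro allI impI)
  let ?X = "linf_c r :: ('a, 'k) linf set"
  fix Y :: "('a, 'k) linf set"
  assume "closed_subspace_of linf_scale ?X Y \<and> isomorphic_spaces linf_scale Y ?X"
  then obtain S T where Y: "module.subspace linf_scale Y" "Y \<subseteq> ?X"
    and hom: "homeomorphism Y ?X S T" and S: "linear_map_on linf_scale Y S"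
    unfolding closed_subspace_of_def isomorphic_spaces_def using closedin_imp_subset by blast
  have T_range: "T ` ?X = Y" and T_in: "\<And>f. f \<in> ?X \<Longrightarrow> T f \<in> Y" and ST: "\<And>f. f \<in> ?X \<Longrightarrow> S (T f) = f"
    and TS: "\<And>y. y \<in> Y \<Longrightarrow> T (S y) = y" and cont: "continuous_on Y S" "continuous_on ?X T"
    using hom unfolding homeomorphism_def by blast+
  have T: "linear_map_on linf_scale ?X T"
    unfolding linear_map_on_def
  proof (intro conjI ballI allI)
    fix f h assume "f \<in> ?X" "h \<in> ?X"
    then have "S (T f + T h) = f + h" "T f + T h \<in> Y"
      using S T_in ST linf_subspaceD(2)[OF Y(1)] unfolding linear_map_on_def by simp_all
    then show "T (f + h) = T f + T h"
      using TS by metis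
  next
    fix s f assume "f \<in> ?X"
    then have "S (linf_scale s (T f)) = linf_scale s f" "linf_scale s (T f) \<in> Y"
      using S T_in ST linf_subspaceD(4)[OF Y(1)] unfolding linear_map_on_def by simp_all
    then show "T (linf_scale s f) = linf_scale s (T f)"
      using TS by metis
  qed
  obtain K where K: "\<And>f. f \<in> ?X \<Longrightarrow> norm (T f) \<le> K * norm f"
    using continuous_linear_map_on_bounded[OF subspace_linf_c T cont(2)] by blast
  obtain L where L: "L > 0" "\<And>y. y \<in> Y \<Longrightarrow> norm (S y) \<le> L * norm y"
    using continuous_linear_map_on_bounded[OF Y(1) S cont(1)] by blast
  define c where "c = 1 / (2 * L)"
  have "\<exists>x. c \<le> norm (linf_coord (T (unit_vec \<alpha>)) x)" if "\<alpha> \<in> Field r" for \<alpha>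
  proof (rule ccontr)
    assume "\<nexists>x. c \<le> norm (linf_coord (T (unit_vec \<alpha>)) x)"
    then have "norm (T (unit_vec \<alpha>)) \<le> c"
      by (intro norm_linf_le) (meson less_imp_le not_le)
    moreover have "1 \<le> L * norm (T (unit_vec \<alpha>))"
      using L(2)[OF T_in[OF unit_vec_linf_c[OF that]]] ST[OF unit_vec_linf_c[OF that]]
      by (simp add: norm_unit_vec)
    ultimately have "1 \<le> L * c"
      using L(1) by (smt (verit) mult_left_mono)
    then show False
      using L(1) by (simp add: c_def)
  qed
  then obtain \<beta> where "\<And>\<alpha>. \<alpha> \<in> Field r \<Longrightarrow> c \<le> norm (linf_coord (T (unit_vec \<alpha>)) (\<beta> \<alpha>))"
    by metis
  moreover have "c > 0"
    using L(1) by (simp add: c_def)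
  ultimately show "\<exists>Z. closed_subspace_of linf_scale ?X Z \<and> complemented_in linf_scale ?X Z \<and>
      Z \<subseteq> Y \<and> isomorphic_spaces linf_scale Z ?X"
    using complemented_copy_in_range[OF inf T _ K] T_range Y(2) by blast
qed

theorem theorem1p3:
  fixes lam :: "'a rel"
  assumes "Card_order lam" and "infinite (Field lam)"
  shows "complementably_homogeneous linf_scale (linf_c lam :: ('a, real) linf set) \<and>
         complementably_homogeneous linf_scale (linf_c lam :: ('a, complex) linf set)"
  using assms(2) by (intro conjI complementably_homogeneous_linf_c)

end
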